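(* Let $\mathcal{C}$ be a preregular category. A sieve in $\mathcal{C}$ is a covering sieve for the regular topology if and only if it contains an effective epimorphism.
   Context: A morphism $f\colon Y\to X$ is an effective epimorphism if for every $e\colon Y\to W$ such that $e\circ g_1=e\circ g_2$ for all $g_1,g_2\colon Z\to Y$ with $f\circ g_1=f\circ g_2$, there is a unique $d\colon X\to W$ with $d\circ f=e$. A category is preregular if for every effective epimorphism $g\colon Z\to Y$ and every morphism $f\colon X\to Y$ there exist an effective epimorphism $h\colon W\to X$ and a morphism $i\colon W\to Z$ with $g\circ i=f\circ h$. The regular topology on a preregular category is the smallest Grothendieck topology in which, for each effective epimorphism $f$, the sieve generated by $f$ is a covering sieve. *)

theory Defs
  imports Main
begin

text \<open>Composition is written in the usual order: \<open>g \<cdot>\<^bsub>C\<^esub> f\<close> is \<open>g\<close> after \<open>f\<close>.\<close>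

record ('o, 'a) category =
  Obj :: "'o set"
  Arr :: "'a set"
  Dom :: "'a \<Rightarrow> 'o"
  Cod :: "'a \<Rightarrow> 'o"
  Id :: "'o \<Rightarrow> 'a"
  Comp :: "'a \<Rightarrow> 'a \<Rightarrow> 'a" (infixl "\<cdot>\<index>" 70)

definition hom :: "('o, 'a, 'm) category_scheme \<Rightarrow> 'o \<Rightarrow> 'o \<Rightarrow> 'a set" where
  "hom C X Y = {f \<in> Arr C. Dom C f = X \<and> Cod C f = Y}"

locale category =
  fixes C :: "('o, 'a, 'm) category_scheme" (structure)
  assumes Dom_Obj: "f \<in> Arr C \<Longrightarrow> Dom C f \<in> Obj C"
    and Cod_Obj: "f \<in> Arr C \<Longrightarrow> Cod C f \<in> Obj C"
    and Id_hom: "X \<in> Obj C \<Longrightarrow> Id C X \<in> hom C X X"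
    and Comp_hom: "\<lbrakk>f \<in> hom C X Y; g \<in> hom C Y Z\<rbrakk> \<Longrightarrow> g \<cdot> f \<in> hom C X Z"
    and Comp_Id: "f \<in> hom C X Y \<Longrightarrow> f \<cdot> Id C X = f"
    and Id_Comp: "f \<in> hom C X Y \<Longrightarrow> Id C Y \<cdot> f = f"
    and Comp_assoc: "\<lbrakk>f \<in> hom C W X; g \<in> hom C X Y; h \<in> hom C Y Z\<rbrakk>
      \<Longrightarrow> (h \<cdot> g) \<cdot> f = h \<cdot> (g \<cdot> f)"

definition effective_epi :: "('o, 'a, 'm) category_scheme \<Rightarrow> 'a \<Rightarrow> bool" where
  "effective_epi C f \<longleftrightarrow> f \<in> Arr C \<and>
    (\<forall>W\<in>Obj C. \<forall>e\<in>hom C (Dom C f) W.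
      (\<forall>Z\<in>Obj C. \<forall>g1\<in>hom C Z (Dom C f). \<forall>g2\<in>hom C Z (Dom C f).
         f \<cdot>\<^bsub>C\<^esub> g1 = f \<cdot>\<^bsub>C\<^esub> g2 \<longrightarrow> e \<cdot>\<^bsub>C\<^esub> g1 = e \<cdot>\<^bsub>C\<^esub> g2) \<longrightarrow>
      (\<exists>!d. d \<in> hom C (Cod C f) W \<and> d \<cdot>\<^bsub>C\<^esub> f = e))"

locale preregular_category = category +
  assumes preregular:
    "\<lbrakk>X \<in> Obj C; Y \<in> Obj C; Z \<in> Obj C; g \<in> hom C Z Y; effective_epi C g; f \<in> hom C X Y\<rbrakk> \<Longrightarrow>
      \<exists>W\<in>Obj C. \<exists>h\<in>hom C W X. \<exists>i\<in>hom C W Z. effective_epi C h \<and> g \<cdot> i = f \<cdot> h"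

definition sieve :: "('o, 'a, 'm) category_scheme \<Rightarrow> 'o \<Rightarrow> 'a set \<Rightarrow> bool" where
  "sieve C X S \<longleftrightarrow> S \<subseteq> {f \<in> Arr C. Cod C f = X} \<and>
    (\<forall>f\<in>S. \<forall>g\<in>Arr C. Cod C g = Dom C f \<longrightarrow> f \<cdot>\<^bsub>C\<^esub> g \<in> S)"

definition maximal_sieve :: "('o, 'a, 'm) category_scheme \<Rightarrow> 'o \<Rightarrow> 'a set" where
  "maximal_sieve C X = {f \<in> Arr C. Cod C f = X}"

definition generated_sieve :: "('o, 'a, 'm) category_scheme \<Rightarrow> 'a \<Rightarrow> 'a set" where
  "generated_sieve C f = {f \<cdot>\<^bsub>C\<^esub> g | g. g \<in> Arr C \<and> Cod C g = Dom C f}"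

definition pullback_sieve :: "('o, 'a, 'm) category_scheme \<Rightarrow> 'a \<Rightarrow> 'a set \<Rightarrow> 'a set" where
  "pullback_sieve C f S = {g \<in> Arr C. Cod C g = Dom C f \<and> f \<cdot>\<^bsub>C\<^esub> g \<in> S}"

text \<open>\<open>J X\<close> is the set of covering sieves on \<open>X\<close>; its value is irrelevant when \<open>X\<close> is not an
  object of \<open>C\<close>.\<close>

definition grothendieck_topology ::
  "('o, 'a, 'm) category_scheme \<Rightarrow> ('o \<Rightarrow> 'a set set) \<Rightarrow> bool" where
  "grothendieck_topology C J \<longleftrightarrow>
    (\<forall>X\<in>Obj C. \<forall>S\<in>J X. sieve C X S) \<and>
    (\<forall>X\<in>Obj C. maximal_sieve C X \<in> J X) \<and>
    (\<forall>X\<in>Obj C. \<forall>S\<in>J X. \<forall>Y\<in>Obj C. \<forall>f\<in>hom C Y X. pullback_sieve C f S \<in> J Y) \<and>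
    (\<forall>X\<in>Obj C. \<forall>S\<in>J X. \<forall>R. sieve C X R \<and>
      (\<forall>f\<in>S. pullback_sieve C f R \<in> J (Dom C f)) \<longrightarrow> R \<in> J X)"

definition effective_epis_cover ::
  "('o, 'a, 'm) category_scheme \<Rightarrow> ('o \<Rightarrow> 'a set set) \<Rightarrow> bool" where
  "effective_epis_cover C J \<longleftrightarrow>
    (\<forall>f. effective_epi C f \<longrightarrow> generated_sieve C f \<in> J (Cod C f))"

text \<open>The smallest topology is formed as an intersection; the lemmas below show that the
  intersection is itself such a topology, hence the least one.\<close>

definition regular_topology :: "('o, 'a, 'm) category_scheme \<Rightarrow> 'o \<Rightarrow> 'a set set" where
  "regular_topology C X = \<Inter> {J X | J. grothendieck_topology C J \<and> effective_epis_cover C J}"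

context category
begin

lemma sieve_maximal: "sieve C X (maximal_sieve C X)"
  using Comp_hom unfolding sieve_def maximal_sieve_def hom_def by blast

lemma sieve_generated:
  assumes "f \<in> Arr C"
  shows "sieve C (Cod C f) (generated_sieve C f)"
  unfolding sieve_def
proof (intro conjI ballI impI)
  show "generated_sieve C f \<subseteq> {h \<in> Arr C. Cod C h = Cod C f}"
    using assms Comp_hom unfolding generated_sieve_def hom_def by blast
next
  fix h g
  assume "h \<in> generated_sieve C f" and g: "g \<in> Arr C" "Cod C g = Dom C h"
  then obtain k where k: "k \<in> Arr C" "Cod C k = Dom C f" "h = f \<cdot> k"
    unfolding generated_sieve_def by blast
  have "Dom C h = Dom C k"
    using Comp_hom[of k "Dom C k" "Dom C f" f "Cod C f"] k assms unfolding hom_def by simp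
  then have kg: "g \<in> hom C (Dom C g) (Dom C k)" "k \<in> hom C (Dom C k) (Dom C f)"
    using g k unfolding hom_def by auto
  have "h \<cdot> g = f \<cdot> (k \<cdot> g)"
    using Comp_assoc[OF kg, of f "Cod C f"] k(3) assms unfolding hom_def by simp
  moreover have "k \<cdot> g \<in> hom C (Dom C g) (Dom C f)"
    using Comp_hom[OF kg] .
  ultimately show "h \<cdot> g \<in> generated_sieve C f"
    unfolding generated_sieve_def hom_def by blast
qed

lemma sieve_pullback:
  assumes "sieve C X S" "f \<in> hom C Y X"
  shows "sieve C Y (pullback_sieve C f S)"
  unfolding sieve_def
proof (intro conjI ballI impI)
  show "pullback_sieve C f S \<subseteq> {h \<in> Arr C. Cod C h = Y}"
    using assms(2) unfolding pullback_sieve_def hom_def by blast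
next
  fix h g
  assume h: "h \<in> pullback_sieve C f S" and g: "g \<in> Arr C" "Cod C g = Dom C h"
  have hh: "h \<in> hom C (Dom C h) Y" "f \<cdot> h \<in> S"
    using h assms(2) unfolding pullback_sieve_def hom_def by auto
  have gg: "g \<in> hom C (Dom C g) (Dom C h)"
    using g unfolding hom_def by simp
  have "Cod C g = Dom C (f \<cdot> h)"
    using Comp_hom[OF hh(1) assms(2)] g unfolding hom_def by simp
  then have "f \<cdot> h \<cdot> g \<in> S"
    using assms(1) hh(2) g unfolding sieve_def by blast
  then have "f \<cdot> (h \<cdot> g) \<in> S"
    using Comp_assoc[OF gg hh(1) assms(2)] by simp
  moreover have "h \<cdot> g \<in> hom C (Dom C g) Y"
    using Comp_hom[OF gg hh(1)] .
  ultimately show "h \<cdot> g \<in> pullback_sieve C f S"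
    using assms(2) unfolding pullback_sieve_def hom_def by simp
qed

lemma discrete_topology:
  "grothendieck_topology C (\<lambda>X. {S. sieve C X S})"
  "effective_epis_cover C (\<lambda>X. {S. sieve C X S})"
  using sieve_maximal sieve_pullback sieve_generated
  unfolding grothendieck_topology_def effective_epis_cover_def effective_epi_def by auto

theorem regular_topology_grothendieck: "grothendieck_topology C (regular_topology C)"
  unfolding grothendieck_topology_def
proof (intro conjI ballI allI impI)
  fix X S
  assume "X \<in> Obj C" "S \<in> regular_topology C X"
  then show "sieve C X S"
    using discrete_topology unfolding regular_topology_def by blast
next
  fix X
  assume "X \<in> Obj C"
  then show "maximal_sieve C X \<in> regular_topology C X"
    unfolding regular_topology_def grothendieck_topology_def by blast
next
  fix X S Y f
  assume "X \<in> Obj C" "S \<in> regular_topology C X" "Y \<in> Obj C" "f \<in> hom C Y X"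
  then show "pullback_sieve C f S \<in> regular_topology C Y"
    unfolding regular_topology_def grothendieck_topology_def by blast
next
  fix X S R
  assume *: "X \<in> Obj C" "S \<in> regular_topology C X"
    "sieve C X R \<and> (\<forall>f\<in>S. pullback_sieve C f R \<in> regular_topology C (Dom C f))"
  have "R \<in> J X" if J: "grothendieck_topology C J" "effective_epis_cover C J" for J
  proof -
    have "S \<in> J X" "\<forall>f\<in>S. pullback_sieve C f R \<in> J (Dom C f)"
      using * J unfolding regular_topology_def by blast+
    then show ?thesis
      using J(1) *(1,3) unfolding grothendieck_topology_def by blast
  qed
  then show "R \<in> regular_topology C X"
    unfolding regular_topology_def by blast
qed

theorem regular_topology_effective_epis_cover: "effective_epis_cover C (regular_topology C)"
  unfolding effective_epis_cover_def regular_topology_def by blast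

theorem regular_topology_least:
  assumes "grothendieck_topology C J" "effective_epis_cover C J"
  shows "regular_topology C X \<subseteq> J X"
  using assms unfolding regular_topology_def by blast

end

end

theory Submission
  imports Defs
begin

text \<open>
  The proof is that the sieves containing an effective epimorphism already form a Grothendieck
  topology. The smallest topology in which effective epimorphisms cover is then contained in it,
  and it contains it as well, because a sieve containing \<open>f\<close> contains the sieve generated by \<open>f\<close>
  and covering sieves are closed upwards.

  Stability under pullback is exactly preregularity. The axiom with content is transitivity: if
  \<open>S\<close> contains an effective epimorphism \<open>f\<close>, and the pullback of \<open>R\<close> along \<open>f\<close> contains an
  effective epimorphism \<open>g\<close>, then \<open>R\<close> contains \<open>f \<cdot> g\<close>, and this has to be an effective
  epimorphism. In an arbitrary category effective epimorphisms need not compose, but in a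
  preregular one they do (\<open>effective_epi_Comp\<close>): the factorisation through \<open>g\<close> of a morphism
  \<open>e\<close> also respects the pairs identified by \<open>f\<close>, since any such pair can be lifted along \<open>g\<close>
  after precomposing with effective epimorphisms, and these can be cancelled.
\<close>

section \<open>Effective epimorphisms\<close>

context category
begin

lemma effective_epi_hom: "effective_epi C f \<Longrightarrow> f \<in> hom C (Dom C f) (Cod C f)"
  unfolding effective_epi_def hom_def by simp

lemma hom_Obj: "f \<in> hom C X Y \<Longrightarrow> X \<in> Obj C \<and> Y \<in> Obj C"
  using Dom_Obj Cod_Obj unfolding hom_def by auto

lemma effective_epi_factor:
  assumes "effective_epi C f" "f \<in> hom C Y X" "e \<in> hom C Y W"
    and "\<And>Z g1 g2. \<lbrakk>g1 \<in> hom C Z Y; g2 \<in> hom C Z Y; f \<cdot> g1 = f \<cdot> g2\<rbrakk> \<Longrightarrow> e \<cdot> g1 = e \<cdot> g2"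
  shows "\<exists>!d. d \<in> hom C X W \<and> d \<cdot> f = e"
proof -
  have "Dom C f = Y" "Cod C f = X"
    using assms(2) unfolding hom_def by auto
  then show ?thesis
    using assms hom_Obj[OF assms(3)] unfolding effective_epi_def by blast
qed

lemma effective_epiI:
  assumes "f \<in> hom C Y X"
    and "\<And>W e. \<lbrakk>e \<in> hom C Y W;
        \<And>Z g1 g2. \<lbrakk>g1 \<in> hom C Z Y; g2 \<in> hom C Z Y; f \<cdot> g1 = f \<cdot> g2\<rbrakk> \<Longrightarrow> e \<cdot> g1 = e \<cdot> g2\<rbrakk>
      \<Longrightarrow> \<exists>!d. d \<in> hom C X W \<and> d \<cdot> f = e"
  shows "effective_epi C f"
proof -
  have f: "f \<in> Arr C" "Dom C f = Y" "Cod C f = X"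
    using assms(1) unfolding hom_def by auto
  show ?thesis
    unfolding effective_epi_def f(2,3)
  proof (intro conjI ballI impI)
    fix W e
    assume "e \<in> hom C Y W"
      and "\<forall>Z\<in>Obj C. \<forall>g1\<in>hom C Z Y. \<forall>g2\<in>hom C Z Y. f \<cdot> g1 = f \<cdot> g2 \<longrightarrow> e \<cdot> g1 = e \<cdot> g2"
    then show "\<exists>!d. d \<in> hom C X W \<and> d \<cdot> f = e"
      using hom_Obj by (intro assms(2)) blast+
  qed (fact f(1))
qed

text \<open>Both \<open>u\<close> and \<open>v\<close> are factorisations of \<open>u \<cdot> f\<close> through \<open>f\<close>, and such a factorisation is
  unique.\<close>

lemma effective_epi_cancel:
  assumes "effective_epi C f" "f \<in> hom C Y X"
    and "u \<in> hom C X W" "v \<in> hom C X W" "u \<cdot> f = v \<cdot> f"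
  shows "u = v"
proof -
  have "u \<cdot> f \<cdot> g1 = u \<cdot> f \<cdot> g2"
    if "g1 \<in> hom C Z Y" "g2 \<in> hom C Z Y" "f \<cdot> g1 = f \<cdot> g2" for Z g1 g2
    using that(3) Comp_assoc[OF that(1) assms(2,3)] Comp_assoc[OF that(2) assms(2,3)] by simp
  then have "\<exists>!d. d \<in> hom C X W \<and> d \<cdot> f = u \<cdot> f"
    using assms Comp_hom by (intro effective_epi_factor) blast+
  then show ?thesis
    using assms(3-5) by auto
qed

lemma effective_epi_Id:
  assumes "X \<in> Obj C"
  shows "effective_epi C (Id C X)"
proof (rule effective_epiI[OF Id_hom[OF assms]])
  fix W e
  assume "e \<in> hom C X W"
  then show "\<exists>!d. d \<in> hom C X W \<and> d \<cdot> Id C X = e"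
    using Comp_Id by metis
qed

end

text \<open>Write \<open>e = d \<cdot> g\<close>. To show that \<open>d\<close> identifies \<open>h1\<close> and \<open>h2\<close> whenever \<open>f\<close> does,
  preregularity is used twice, to lift first \<open>h1\<close> and then \<open>h2\<close> along \<open>g\<close> over a common domain;
  the lifts are identified by \<open>f \<cdot> g\<close>, hence by \<open>e\<close>.\<close>

lemma (in preregular_category) effective_epi_Comp:
  assumes f: "effective_epi C f" "f \<in> hom C Y X"
    and g: "effective_epi C g" "g \<in> hom C Z Y"
  shows "effective_epi C (f \<cdot> g)"
proof (rule effective_epiI)
  show fg: "f \<cdot> g \<in> hom C Z X"
    using Comp_hom[OF g(2) f(2)] .
  fix W e
  assume e: "e \<in> hom C Z W"
    and resp: "\<And>V k1 k2. \<lbrakk>k1 \<in> hom C V Z; k2 \<in> hom C V Z; f \<cdot> g \<cdot> k1 = f \<cdot> g \<cdot> k2\<rbrakk>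
      \<Longrightarrow> e \<cdot> k1 = e \<cdot> k2"
  have "e \<cdot> k1 = e \<cdot> k2"
    if "k1 \<in> hom C V Z" "k2 \<in> hom C V Z" "g \<cdot> k1 = g \<cdot> k2" for V k1 k2
    using resp[OF that(1,2)] that(3) Comp_assoc[OF that(1) g(2) f(2)]
      Comp_assoc[OF that(2) g(2) f(2)] by simp
  then obtain d where d: "d \<in> hom C Y W" "d \<cdot> g = e"
    using effective_epi_factor[OF g e] by blast
  have "d \<cdot> h1 = d \<cdot> h2"
    if h: "h1 \<in> hom C V Y" "h2 \<in> hom C V Y" "f \<cdot> h1 = f \<cdot> h2" for V h1 h2
  proof -
    have obj: "V \<in> Obj C" "Y \<in> Obj C" "Z \<in> Obj C"
      using hom_Obj h(1) g(2) by blast+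
    obtain V1 p i1 where p: "V1 \<in> Obj C" "p \<in> hom C V1 V" "i1 \<in> hom C V1 Z"
        "effective_epi C p" "g \<cdot> i1 = h1 \<cdot> p"
      using preregular[OF obj g(2,1) h(1)] by blast
    have h2p: "h2 \<cdot> p \<in> hom C V1 Y"
      using Comp_hom[OF p(2) h(2)] .
    obtain V2 q i2 where q: "V2 \<in> Obj C" "q \<in> hom C V2 V1" "i2 \<in> hom C V2 Z"
        "effective_epi C q" "g \<cdot> i2 = h2 \<cdot> p \<cdot> q"
      using preregular[OF p(1) obj(2,3) g(2,1) h2p] by blast
    have i1q: "i1 \<cdot> q \<in> hom C V2 Z"
      using Comp_hom[OF q(2) p(3)] .
    have pq: "p \<cdot> q \<in> hom C V2 V"
      using Comp_hom[OF q(2) p(2)] .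
    have lift1: "g \<cdot> (i1 \<cdot> q) = h1 \<cdot> (p \<cdot> q)"
      using Comp_assoc[OF q(2) p(3) g(2)] Comp_assoc[OF q(2) p(2) h(1)] p(5) by simp
    have lift2: "g \<cdot> i2 = h2 \<cdot> (p \<cdot> q)"
      using Comp_assoc[OF q(2) p(2) h(2)] q(5) by simp
    have "f \<cdot> g \<cdot> (i1 \<cdot> q) = f \<cdot> h1 \<cdot> (p \<cdot> q)"
      using Comp_assoc[OF i1q g(2) f(2)] Comp_assoc[OF pq h(1) f(2)] lift1 by simp
    also have "\<dots> = f \<cdot> g \<cdot> i2"
      using Comp_assoc[OF q(3) g(2) f(2)] Comp_assoc[OF pq h(2) f(2)] lift2 h(3) by simp
    finally have "e \<cdot> (i1 \<cdot> q) = e \<cdot> i2"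
      using resp i1q q(3) by blast
    then have "d \<cdot> (h1 \<cdot> (p \<cdot> q)) = d \<cdot> (h2 \<cdot> (p \<cdot> q))"
      using Comp_assoc[OF i1q g(2) d(1)] Comp_assoc[OF q(3) g(2) d(1)] lift1 lift2 d(2) by simp
    then have "d \<cdot> h1 \<cdot> p \<cdot> q = d \<cdot> h2 \<cdot> p \<cdot> q"
      using Comp_assoc[OF pq h(1) d(1)] Comp_assoc[OF pq h(2) d(1)]
        Comp_assoc[OF q(2) p(2) Comp_hom[OF h(1) d(1)]]
        Comp_assoc[OF q(2) p(2) Comp_hom[OF h(2) d(1)]] by simp
    moreover have dh: "d \<cdot> h1 \<in> hom C V W" "d \<cdot> h2 \<in> hom C V W"
      using Comp_hom h d(1) by blast+
    ultimately have "d \<cdot> h1 \<cdot> p = d \<cdot> h2 \<cdot> p"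
      using effective_epi_cancel[OF q(4,2)] Comp_hom[OF p(2)] by blast
    then show ?thesis
      using effective_epi_cancel[OF p(4,2) dh] by blast
  qed
  then obtain c where c: "c \<in> hom C X W" "c \<cdot> f = d"
    using effective_epi_factor[OF f d(1)] by blast
  show "\<exists>!c. c \<in> hom C X W \<and> c \<cdot> (f \<cdot> g) = e"
  proof (intro ex1I[of _ c] conjI)
    show "c \<cdot> (f \<cdot> g) = e"
      using Comp_assoc[OF g(2) f(2) c(1)] c(2) d(2) by simp
  next
    fix b
    assume b: "b \<in> hom C X W \<and> b \<cdot> (f \<cdot> g) = e"
    then have "b \<cdot> f \<cdot> g = d \<cdot> g"
      using Comp_assoc[OF g(2) f(2), of b W] d(2) by simp
    then have "b \<cdot> f = d"
      using effective_epi_cancel[OF g] Comp_hom[OF f(2)] b d(1) by blast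
    then show "b = c"
      using effective_epi_cancel[OF f] b c by blast
  qed (fact c(1))
qed

section \<open>The topology of sieves containing an effective epimorphism\<close>

definition effective_epi_sieves ::
  "('o, 'a, 'm) category_scheme \<Rightarrow> 'o \<Rightarrow> 'a set set" where
  "effective_epi_sieves C X = {S. sieve C X S \<and> (\<exists>f\<in>S. effective_epi C f)}"

lemma (in preregular_category) pullback_effective_epi_sieve:
  assumes S: "S \<in> effective_epi_sieves C X" and h: "h \<in> hom C Y X"
  shows "pullback_sieve C h S \<in> effective_epi_sieves C Y"
proof -
  obtain f where f: "f \<in> S" "effective_epi C f"
    using S unfolding effective_epi_sieves_def by blast
  have fX: "f \<in> hom C (Dom C f) X"
    using S f unfolding effective_epi_sieves_def sieve_def hom_def by blast
  obtain W k i where k: "k \<in> hom C W Y" "i \<in> hom C W (Dom C f)" "effective_epi C k"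
      "f \<cdot> i = h \<cdot> k"
    using preregular[OF _ _ _ fX f(2) h] hom_Obj[OF fX] hom_Obj[OF h] by blast
  have "f \<cdot> i \<in> S"
    using S f(1) k(2) unfolding effective_epi_sieves_def sieve_def hom_def by simp
  then have "k \<in> pullback_sieve C h S"
    using k h unfolding pullback_sieve_def hom_def by simp
  then show ?thesis
    using k(3) S h sieve_pullback unfolding effective_epi_sieves_def by blast
qed

lemma (in preregular_category) grothendieck_topology_effective_epi_sieves:
  "grothendieck_topology C (effective_epi_sieves C)"
  unfolding grothendieck_topology_def
proof (intro conjI ballI allI impI)
  fix X S
  assume "S \<in> effective_epi_sieves C X"
  then show "sieve C X S"
    unfolding effective_epi_sieves_def by blast
next
  fix X
  assume X: "X \<in> Obj C"
  have "Id C X \<in> maximal_sieve C X"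
    using Id_hom[OF X] unfolding maximal_sieve_def hom_def by blast
  then show "maximal_sieve C X \<in> effective_epi_sieves C X"
    using sieve_maximal effective_epi_Id[OF X] unfolding effective_epi_sieves_def by blast
next
  fix X S Y f
  assume "S \<in> effective_epi_sieves C X" "f \<in> hom C Y X"
  then show "pullback_sieve C f S \<in> effective_epi_sieves C Y"
    by (rule pullback_effective_epi_sieve)
next
  fix X S R
  assume S: "S \<in> effective_epi_sieves C X"
    and R: "sieve C X R \<and> (\<forall>f\<in>S. pullback_sieve C f R \<in> effective_epi_sieves C (Dom C f))"
  obtain f where f: "f \<in> S" "effective_epi C f"
    using S unfolding effective_epi_sieves_def by blast
  then obtain g where g: "g \<in> pullback_sieve C f R" "effective_epi C g"
    using R unfolding effective_epi_sieves_def by blast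
  have g': "g \<in> hom C (Dom C g) (Dom C f)" "f \<cdot> g \<in> R"
    using g(1) unfolding pullback_sieve_def hom_def by auto
  have "effective_epi C (f \<cdot> g)"
    using effective_epi_Comp[OF f(2) effective_epi_hom[OF f(2)] g(2) g'(1)] .
  then show "R \<in> effective_epi_sieves C X"
    using R g'(2) unfolding effective_epi_sieves_def by blast
qed

lemma (in category) effective_epis_cover_effective_epi_sieves:
  "effective_epis_cover C (effective_epi_sieves C)"
  unfolding effective_epis_cover_def
proof (intro allI impI)
  fix f
  assume f: "effective_epi C f"
  have fh: "f \<in> hom C (Dom C f) (Cod C f)"
    using effective_epi_hom[OF f] .
  have "Id C (Dom C f) \<in> hom C (Dom C f) (Dom C f)"
    using Id_hom hom_Obj[OF fh] by blast
  then have "f \<in> generated_sieve C f"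
    using Comp_Id[OF fh] unfolding generated_sieve_def hom_def by force
  moreover have "sieve C (Cod C f) (generated_sieve C f)"
    using sieve_generated fh unfolding hom_def by blast
  ultimately show "generated_sieve C f \<in> effective_epi_sieves C (Cod C f)"
    using f unfolding effective_epi_sieves_def by blast
qed

section \<open>Comparison with the regular topology\<close>

text \<open>A larger sieve pulls back to the maximal sieve along every member of the smaller one, so
  transitivity applies.\<close>

lemma (in category) grothendieck_topology_upward_closed:
  assumes J: "grothendieck_topology C J" and X: "X \<in> Obj C"
    and T: "T \<in> J X" "T \<subseteq> S" and S: "sieve C X S"
  shows "S \<in> J X"
proof -
  have "pullback_sieve C g S \<in> J (Dom C g)" if g: "g \<in> T" for g
  proof -
    have "g \<in> S" "g \<in> Arr C"
      using g T(2) S unfolding sieve_def by auto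
    then have "pullback_sieve C g S = maximal_sieve C (Dom C g)"
      using S unfolding pullback_sieve_def maximal_sieve_def sieve_def by blast
    moreover have "maximal_sieve C (Dom C g) \<in> J (Dom C g)"
      using J Dom_Obj[OF \<open>g \<in> Arr C\<close>] unfolding grothendieck_topology_def by blast
    ultimately show ?thesis
      by simp
  qed
  then show ?thesis
    using J X T(1) S unfolding grothendieck_topology_def by blast
qed

theorem lemma6p2:
  fixes C :: "('o, 'a, 'm) category_scheme" and X :: 'o and S :: "'a set"
  assumes "preregular_category C"
    and "X \<in> Obj C"
    and "sieve C X S"
  shows "S \<in> regular_topology C X \<longleftrightarrow> (\<exists>f\<in>S. effective_epi C f)"
proof -
  interpret preregular_category C
    by (fact assms(1))
  show ?thesis
  proof
    assume "S \<in> regular_topology C X"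
    then have "S \<in> effective_epi_sieves C X"
      using regular_topology_least[OF grothendieck_topology_effective_epi_sieves
          effective_epis_cover_effective_epi_sieves] by blast
    then show "\<exists>f\<in>S. effective_epi C f"
      unfolding effective_epi_sieves_def by blast
  next
    assume "\<exists>f\<in>S. effective_epi C f"
    then obtain f where f: "f \<in> S" "effective_epi C f"
      by blast
    have "Cod C f = X"
      using f(1) assms(3) unfolding sieve_def by blast
    then have "generated_sieve C f \<in> regular_topology C X"
      using regular_topology_effective_epis_cover f(2) unfolding effective_epis_cover_def by blast
    moreover have "generated_sieve C f \<subseteq> S"
      using f(1) assms(3) unfolding generated_sieve_def sieve_def by blast
    ultimately show "S \<in> regular_topology C X"
      using grothendieck_topology_upward_closed[OF regular_topology_grothendieck assms(2)] assms(3)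
      by blast
  qed
qed

end
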